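(* Let $\mu$ be an $(\alpha-1)$-parametrization of $\mathcal{K}_0^n$ (with $\alpha\ne 0$, $\alpha\neq 1$), and let $F:\mathcal{K}_0^n\to\mathbb{R}^+$ be given by $$F(K)=\frac{1}{|\alpha|}\int_{\mathbb{S}^{n-1}}h(K)\,d\mu(K)\qquad\forall K\in\mathcal{K}_0^n .$$ Assume that $F$ satisfies the Brunn-Minkowski inequality $$F^{1/\alpha}(K+L)\ge F^{1/\alpha}(K)+F^{1/\alpha}(L)\qquad\forall K,L\in\mathcal{K}_0^n ,\tag{BM}$$ and that its first variation under Minkowski sums can be written as $$\frac{d}{dt}F(K+tL)\Big|_{t=0^+}=\frac{\alpha}{|\alpha|}\int_{\mathbb{S}^{n-1}}h(L)\,d\mu(K)\qquad\forall K,L\in\mathcal{K}_0^n .$$ Then $F$ is $\mu$-concave, i.e. $$F^{1-(1/\alpha)}(K+_\mu L)\ \ge\ F^{1-(1/\alpha)}(K)+F^{1-(1/\alpha)}(L)\qquad\forall K,L\in\mathcal{K}_0^n .\tag{KS}$$ Moreover, if equality occurs in (BM) only when $K$ and $L$ are homothetic, then equality occurs in (KS) only when $K$ and $L$ are homothetic.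
   Context: $\mathcal{K}_0^n$ is the class of compact convex sets in $\mathbb{R}^n$ with nonempty interior; $\mathbb{R}^+=(0,\infty)$; $h(K)(\nu)=\sup_{x\in K}x\cdot\nu$, $\nu\in\mathbb{S}^{n-1}$, is the support function; $K+tL$ denotes Minkowski combinations; $\mathcal{M}^+(\mathbb{S}^{n-1})$ is the class of (finite Borel) positive measures on $\mathbb{S}^{n-1}$. A map $\mu:\mathcal{K}_0^n\to\mathcal{M}^+(\mathbb{S}^{n-1})$ is a parametrization of $\mathcal{K}_0^n$ if (i) the image $\mu(\mathcal{K}_0^n)$ is a convex cone: $\nu_1,\nu_2\in\mu(\mathcal{K}_0^n)$, $t_1,t_2>0$ imply $t_1\nu_1+t_2\nu_2\in\mu(\mathcal{K}_0^n)$; (ii) $\mu$ is injective up to translations: $\mu(K_1)=\mu(K_2)$ if and only if $K_1$ and $K_2$ are translates. It is an $(\alpha-1)$-parametrization if in addition (iii) $\mu$ is $(\alpha-1)$-homogeneous for some $\alpha\ne1$: $\mu(tK)=t^{\alpha-1}\mu(K)$ for all $K\in\mathcal{K}_0^n$, $t>0$. For a parametrization $\mu$ and $K,L\in\mathcal{K}_0^n$, $K+_\mu L\in\mathcal{K}_0^n$ is the convex body, determined up to translation, such that $\mu(K+_\mu L)=\mu(K)+\mu(L)$. Two bodies are homothetic if one is a translate of a positive multiple of the other. *)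

theory Defs
  imports "HOL-Analysis.Analysis"
begin

text \<open>Minkowski sums are the pointwise set sums \<open>K + L\<close> of \<open>HOL-Library.Set_Algebras\<close>, and
  dilates are the images \<open>(*\<^sub>R) t ` K\<close>.\<close>

definition convex_bodies :: "(real ^ 'n) set set" where
  "convex_bodies = {K. compact K \<and> convex K \<and> interior K \<noteq> {}}"

definition translates :: "(real ^ 'n) set \<Rightarrow> (real ^ 'n) set \<Rightarrow> bool" where
  "translates K L \<longleftrightarrow> (\<exists>x. K = (+) x ` L)"

definition homothetic :: "(real ^ 'n) set \<Rightarrow> (real ^ 'n) set \<Rightarrow> bool" where
  "homothetic K L \<longleftrightarrow> (\<exists>t>0. translates K ((*\<^sub>R) t ` L))"

text \<open>The supremum is only meaningful for nonempty bounded sets, in particular for convex bodies.\<close>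

definition support_function :: "(real ^ 'n) set \<Rightarrow> real ^ 'n \<Rightarrow> real" where
  "support_function K \<nu> = (SUP x\<in>K. x \<bullet> \<nu>)"

definition sphere_measures :: "(real ^ 'n) measure set" where
  "sphere_measures =
     {M. finite_measure M \<and> sets M = sets (restrict_space borel (sphere 0 1))}"

text \<open>Setwise sum of two measures on the same \<open>\<sigma>\<close>-algebra.\<close>

definition add_measure :: "'a measure \<Rightarrow> 'a measure \<Rightarrow> 'a measure" where
  "add_measure M N = measure_of (space M) (sets M) (\<lambda>A. emeasure M A + emeasure N A)"

lemma sets_add_measure [simp]: "sets (add_measure M N) = sets M"
  by (simp add: add_measure_def)

lemma space_add_measure [simp]: "space (add_measure M N) = space M"
  by (simp add: add_measure_def)

lemma emeasure_add_measure:
  assumes "sets M = sets N"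
  shows "emeasure (add_measure M N) A = emeasure M A + emeasure N A"
proof (cases "A \<in> sets M")
  case True
  have "countably_additive (sets M) (\<lambda>A. emeasure M A + emeasure N A)"
  proof (rule countably_additiveI)
    fix A :: "nat \<Rightarrow> 'a set"
    assume *: "range A \<subseteq> sets M" "disjoint_family A" "(\<Union>i. A i) \<in> sets M"
    have "(\<Sum>i. emeasure M (A i) + emeasure N (A i))
        = (\<Sum>i. emeasure M (A i)) + (\<Sum>i. emeasure N (A i))"
      by (intro suminf_add [symmetric]) auto
    also have "\<dots> = emeasure M (\<Union>i. A i) + emeasure N (\<Union>i. A i)"
      using * assms by (simp add: suminf_emeasure)
    finally show "(\<Sum>i. emeasure M (A i) + emeasure N (A i))
        = emeasure M (\<Union>i. A i) + emeasure N (\<Union>i. A i)" .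
  qed
  then show ?thesis
    using True unfolding add_measure_def
    by (intro emeasure_measure_of_sigma) (auto simp: positive_def sets.sigma_algebra_axioms)
next
  case False
  then show ?thesis using assms by (simp add: emeasure_notin_sets)
qed

definition parametrization :: "((real ^ 'n) set \<Rightarrow> (real ^ 'n) measure) \<Rightarrow> bool" where
  "parametrization \<mu> \<longleftrightarrow>
     \<mu> ` convex_bodies \<subseteq> sphere_measures \<and>
     (\<forall>\<nu>1\<in>\<mu> ` convex_bodies. \<forall>\<nu>2\<in>\<mu> ` convex_bodies. \<forall>t1>0. \<forall>t2>0::real.
        add_measure (scale_measure (ennreal t1) \<nu>1) (scale_measure (ennreal t2) \<nu>2)
          \<in> \<mu> ` convex_bodies) \<and>
     (\<forall>K1\<in>convex_bodies. \<forall>K2\<in>convex_bodies. \<mu> K1 = \<mu> K2 \<longleftrightarrow> translates K1 K2)"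

text \<open>The parameter \<open>p\<close> is the degree of homogeneity, that is \<open>p = \<alpha> - 1\<close>.\<close>

definition homogeneous_parametrization ::
    "real \<Rightarrow> ((real ^ 'n) set \<Rightarrow> (real ^ 'n) measure) \<Rightarrow> bool" where
  "homogeneous_parametrization p \<mu> \<longleftrightarrow>
     parametrization \<mu> \<and> p \<noteq> 0 \<and>
     (\<forall>K\<in>convex_bodies. \<forall>t>0. \<mu> ((*\<^sub>R) t ` K) = scale_measure (ennreal (t powr p)) (\<mu> K))"

text \<open>The body \<open>K +\<^sub>\<mu> L\<close> is determined only up to translation, so it is rendered as a relation:
  \<open>is_mu_sum \<mu> K L M\<close> says that \<open>M\<close> is one of its representatives.\<close>

definition is_mu_sum ::
    "((real ^ 'n) set \<Rightarrow> (real ^ 'n) measure) \<Rightarrow>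
     (real ^ 'n) set \<Rightarrow> (real ^ 'n) set \<Rightarrow> (real ^ 'n) set \<Rightarrow> bool" where
  "is_mu_sum \<mu> K L M \<longleftrightarrow> M \<in> convex_bodies \<and> \<mu> M = add_measure (\<mu> K) (\<mu> L)"

lemma is_mu_sum_exists:
  assumes "parametrization \<mu>" "K \<in> convex_bodies" "L \<in> convex_bodies"
  shows "\<exists>M. is_mu_sum \<mu> K L M"
proof -
  have "add_measure (scale_measure (ennreal 1) (\<mu> K)) (scale_measure (ennreal 1) (\<mu> L))
      \<in> \<mu> ` convex_bodies"
    using assms zero_less_one unfolding parametrization_def by blast
  then show ?thesis by (auto simp: is_mu_sum_def)
qed

lemma is_mu_sum_unique:
  assumes "parametrization \<mu>" "is_mu_sum \<mu> K L M"
  shows "is_mu_sum \<mu> K L M' \<longleftrightarrow> M' \<in> convex_bodies \<and> translates M' M"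
  using assms unfolding is_mu_sum_def parametrization_def by metis

end

theory Submission
  imports Defs
begin

text \<open>
  Write \<open>G = F powr (1/\<alpha>)\<close> and \<open>W K M = 1/\<bar>\<alpha>\<bar> * (\<integral>\<nu>. support_function M \<nu> \<partial>\<mu> K)\<close>, so that
  \<open>W M M = F M\<close>. The integral defining \<open>F\<close> pairs a function of degree one in \<open>K\<close> with a measure of
  degree \<open>\<alpha> - 1\<close>, hence \<open>G\<close> is positively homogeneous of degree one, and (BM) says that it is
  superadditive. Together these make \<open>G\<close> concave along the segment from \<open>K\<close> to \<open>K + M\<close>. A concave
  function has an initial slope at least as large as its total increment. The variation formula
  identifies the slope as \<open>F K powr (1/\<alpha> - 1) * W K M\<close>, so
  \<open>W K M \<ge> F K powr (1 - 1/\<alpha>) * (G (K + M) - G K) \<ge> F K powr (1 - 1/\<alpha>) * G M\<close>.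
  The second inequality is (BM) once more; the outer two terms are the Minkowski inequality for \<open>F\<close>.

  Let \<open>M\<close> represent the \<open>\<mu>\<close>-sum of \<open>K\<close> and \<open>L\<close>. Integrating against \<open>\<mu> M = \<mu> K + \<mu> L\<close> gives
  \<open>F M = W K M + W L M\<close>. Adding the two Minkowski inequalities and dividing by
  \<open>F M powr (1/\<alpha>)\<close> yields (KS).

  If equality holds in (KS), it holds in both chains above. In particular
  \<open>G (K + M) = G K + G M\<close> and \<open>G (L + M) = G L + G M\<close>, so equality in (BM) occurs for \<open>K, M\<close> and for
  \<open>L, M\<close>. If that forces homothety, then \<open>K\<close> and \<open>L\<close> are both homothetic to \<open>M\<close>, hence to each other.
  Keeping the middle term of the chain is what makes the equality case immediate.
\<close>

section \<open>Integration against sums and multiples of measures\<close>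

lemma nn_integral_add_measure:
  assumes sets: "sets M = sets N" and f: "f \<in> borel_measurable M"
  shows "(\<integral>\<^sup>+x. f x \<partial>add_measure M N) = (\<integral>\<^sup>+x. f x \<partial>M) + (\<integral>\<^sup>+x. f x \<partial>N)"
proof -
  have meas: "g \<in> borel_measurable N" "g \<in> borel_measurable (add_measure M N)"
    if "g \<in> borel_measurable M" for g :: "'a \<Rightarrow> ennreal"
    using that measurable_cong_sets[OF sets refl, of "borel :: ennreal measure"]
      measurable_cong_sets[OF sets_add_measure refl, of M N "borel :: ennreal measure"]
    by auto
  show ?thesis
    using f
  proof (induction f rule: borel_measurable_induct)
    case (cong f g)
    have "space N = space M"
      using sets by (metis sets_eq_imp_space_eq)
    with cong.hyps have "(\<integral>\<^sup>+x. f x \<partial>M) = (\<integral>\<^sup>+x. g x \<partial>M)" "(\<integral>\<^sup>+x. f x \<partial>N) = (\<integral>\<^sup>+x. g x \<partial>N)"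
      "(\<integral>\<^sup>+x. f x \<partial>add_measure M N) = (\<integral>\<^sup>+x. g x \<partial>add_measure M N)"
      by (auto intro!: nn_integral_cong)
    with cong.IH show ?case by argo
  next
    case (set A)
    then show ?case using sets by (simp add: emeasure_add_measure)
  next
    case (mult u c)
    then show ?case by (simp add: meas nn_integral_cmult distrib_left)
  next
    case (add u v)
    then show ?case by (simp add: meas nn_integral_add ac_simps)
  next
    case (seq U)
    have mono: "incseq (\<lambda>i. \<integral>\<^sup>+x. U i x \<partial>M)" "incseq (\<lambda>i. \<integral>\<^sup>+x. U i x \<partial>N)"
      using \<open>incseq U\<close> by (auto simp: incseq_def le_fun_def intro!: nn_integral_mono)
    show ?case
      using seq
      by (simp add: meas SUP_apply[abs_def] image_comp comp_def nn_integral_monotone_convergence_SUP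
          ennreal_SUP_add[OF mono])
  qed
qed

text \<open>The integral of an integrable real function is a difference of two finite nonnegative
  integrals, and additivity holds for each of these separately.\<close>

lemma integral_add_measure:
  fixes f :: "'a \<Rightarrow> real"
  assumes sets: "sets M = sets N" and int: "integrable (add_measure M N) f"
  shows "(\<integral>x. f x \<partial>add_measure M N) = (\<integral>x. f x \<partial>M) + (\<integral>x. f x \<partial>N)"
proof -
  have [measurable]: "f \<in> borel_measurable M"
    using borel_measurable_integrable[OF int]
    by (subst (asm) measurable_cong_sets[OF sets_add_measure refl])
  then have fN: "f \<in> borel_measurable N"
    by (subst (asm) measurable_cong_sets[OF sets refl])
  have split: "(\<integral>\<^sup>+x. g x \<partial>add_measure M N) = (\<integral>\<^sup>+x. g x \<partial>M) + (\<integral>\<^sup>+x. g x \<partial>N)"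
    if "g \<in> borel_measurable M" for g
    using nn_integral_add_measure[OF sets that] .
  have pos: "(\<integral>\<^sup>+x. ennreal (f x) \<partial>add_measure M N)
      = (\<integral>\<^sup>+x. ennreal (f x) \<partial>M) + (\<integral>\<^sup>+x. ennreal (f x) \<partial>N)"
    and neg: "(\<integral>\<^sup>+x. ennreal (- f x) \<partial>add_measure M N)
      = (\<integral>\<^sup>+x. ennreal (- f x) \<partial>M) + (\<integral>\<^sup>+x. ennreal (- f x) \<partial>N)"
    by (auto intro!: split)
  have fin: "(\<integral>\<^sup>+x. ennreal (f x) \<partial>add_measure M N) \<noteq> \<infinity>"
    "(\<integral>\<^sup>+x. ennreal (- f x) \<partial>add_measure M N) \<noteq> \<infinity>"
    using int by (auto simp: real_integrable_def)
  then have "integrable M f" "integrable N f"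
    using pos neg fN by (auto simp: real_integrable_def)
  with int fin pos neg show ?thesis
    by (auto simp: real_lebesgue_integral_def enn2real_plus less_top)
qed

lemma integral_scale_measure:
  fixes f :: "'a \<Rightarrow> real"
  assumes "c > 0"
  shows "(\<integral>x. f x \<partial>scale_measure (ennreal c) M) = c * (\<integral>x. f x \<partial>M)"
proof -
  have "scale_measure (ennreal c) M = density M (\<lambda>_. ennreal c)"
    by (rule measure_eqI) (auto simp: emeasure_density_const)
  moreover have "(\<integral>x. f x \<partial>density M (\<lambda>_. ennreal c)) = c * (\<integral>x. f x \<partial>M)"
  proof (cases "f \<in> borel_measurable M")
    case True
    then show ?thesis using assms by (simp add: integral_density)
  next
    case False
    then have "\<not> integrable M f" "\<not> integrable (density M (\<lambda>_. ennreal c)) f"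
      by (auto dest: borel_measurable_integrable)
    then show ?thesis by (simp add: not_integrable_integral_eq)
  qed
  ultimately show ?thesis by simp
qed

section \<open>Minkowski operations on convex bodies\<close>

lemma convex_bodies_scaleR:
  fixes K :: "(real ^ 'n) set"
  assumes "K \<in> convex_bodies" "t > 0"
  shows "(*\<^sub>R) t ` K \<in> convex_bodies"
  using assms interior_injective_linear_image[of "(*\<^sub>R) t" K]
    injective_scaleR[of t, where ?'a = "real ^ 'n"]
  by (auto simp: convex_bodies_def compact_scaling convex_scaling)

lemma convex_bodies_plus:
  fixes K L :: "(real ^ 'n) set"
  assumes "K \<in> convex_bodies" "L \<in> convex_bodies"
  shows "K + L \<in> convex_bodies"
proof -
  from assms have K: "compact K" "convex K" "interior K \<noteq> {}"
    and L: "compact L" "convex L" "interior L \<noteq> {}"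
    by (auto simp: convex_bodies_def)
  obtain x where "x \<in> L" using L(3) interior_subset by fastforce
  then have "(+) x ` K \<subseteq> K + L"
    by (auto simp: set_plus_def add.commute)
  then have "(+) x ` interior K \<subseteq> interior (K + L)"
    by (metis interior_mono interior_translation)
  moreover have "K + L = (\<Union>x\<in>K. \<Union>y\<in>L. {x + y})"
    by (auto simp: set_plus_def)
  ultimately show ?thesis
    using K L compact_sums'[OF K(1) L(1)] convex_set_plus[OF K(2) L(2)]
    by (auto simp: convex_bodies_def)
qed

lemma plus_scaleR_zero:
  assumes "L \<noteq> {}"
  shows "K + (*\<^sub>R) 0 ` L = (K :: 'a::real_vector set)"
  using assms by (auto simp: set_plus_def)

text \<open>Convexity of \<open>K\<close> enters through \<open>K = (1 - s) K + s K\<close>; the identity displays \<open>K + s L\<close> as a point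
  of the Minkowski segment from \<open>K\<close> to \<open>K + L\<close>.\<close>

lemma plus_scaleR_eq_segment:
  fixes K L :: "'a::real_vector set"
  assumes "convex K" "0 \<le> s" "s \<le> 1"
  shows "K + (*\<^sub>R) s ` L = (*\<^sub>R) (1 - s) ` K + (*\<^sub>R) s ` (K + L)"
proof (intro set_eqI iffI)
  fix z assume "z \<in> K + (*\<^sub>R) s ` L"
  then obtain x y where xy: "x \<in> K" "y \<in> L" "z = x + s *\<^sub>R y"
    by (auto simp: set_plus_def)
  then have z: "z = (1 - s) *\<^sub>R x + s *\<^sub>R (x + y)"
    by (simp add: algebra_simps)
  from xy show "z \<in> (*\<^sub>R) (1 - s) ` K + (*\<^sub>R) s ` (K + L)"
    unfolding z by (intro set_plus_intro imageI)
next
  fix z assume "z \<in> (*\<^sub>R) (1 - s) ` K + (*\<^sub>R) s ` (K + L)"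
  then obtain x x' y where xy: "x \<in> K" "x' \<in> K" "y \<in> L" "z = (1 - s) *\<^sub>R x + s *\<^sub>R (x' + y)"
    by (auto simp: set_plus_def)
  then have z: "z = ((1 - s) *\<^sub>R x + s *\<^sub>R x') + s *\<^sub>R y"
    by (simp add: algebra_simps)
  have "(1 - s) *\<^sub>R x + s *\<^sub>R x' \<in> K"
    using assms xy by (auto intro: convexD)
  with xy show "z \<in> K + (*\<^sub>R) s ` L"
    unfolding z by (intro set_plus_intro imageI)
qed

lemma support_function_scaleR:
  fixes K :: "(real ^ 'n) set"
  assumes "compact K" "K \<noteq> {}" "t > 0"
  shows "support_function ((*\<^sub>R) t ` K) \<nu> = t * support_function K \<nu>"
proof -
  have "compact ((\<lambda>x. x \<bullet> \<nu>) ` K)"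
    using assms by (intro compact_continuous_image continuous_intros)
  then have "bdd_above ((\<lambda>x. x \<bullet> \<nu>) ` K)"
    by (intro bounded_imp_bdd_above compact_imp_bounded)
  moreover have "continuous (at_left (SUP x\<in>K. x \<bullet> \<nu>)) ((*) t)"
    by (intro continuous_intros)
  moreover have "mono ((*) t)"
    using assms by (auto simp: mono_def)
  ultimately show ?thesis
    using assms continuous_at_Sup_mono[of "(*) t" "(\<lambda>x. x \<bullet> \<nu>) ` K"]
    by (simp add: support_function_def image_comp comp_def)
qed

lemma homothetic_sym:
  assumes "homothetic K L"
  shows "homothetic L K"
proof -
  from assms obtain t x where t: "t > 0" and K: "K = (+) x ` (*\<^sub>R) t ` L"
    by (auto simp: homothetic_def translates_def)
  have "L = (+) (- ((1 / t) *\<^sub>R x)) ` (*\<^sub>R) (1 / t) ` K"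
    using t unfolding K by (simp add: image_comp comp_def algebra_simps)
  moreover have "1 / t > 0" using t by simp
  ultimately show ?thesis
    unfolding homothetic_def translates_def by blast
qed

lemma homothetic_trans:
  assumes "homothetic K L" "homothetic L M"
  shows "homothetic K M"
proof -
  from assms obtain s t x y where st: "s > 0" "t > 0"
    and K: "K = (+) x ` (*\<^sub>R) s ` L" and L: "L = (+) y ` (*\<^sub>R) t ` M"
    by (auto simp: homothetic_def translates_def)
  have "K = (+) (x + s *\<^sub>R y) ` (*\<^sub>R) (s * t) ` M"
    unfolding K L by (simp add: image_comp comp_def algebra_simps)
  moreover have "s * t > 0" using st by simp
  ultimately show ?thesis
    unfolding homothetic_def translates_def by blast
qed

section \<open>Brunn-Minkowski implies Minkowski\<close>

text \<open>Superadditivity and homogeneity make the functional concave along the segment from \<open>K\<close> to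
  \<open>K + L\<close>, and a concave function lies below its tangent at the starting point. The increment is
  deliberately not estimated further: it carries the information about the equality case.\<close>

lemma first_variation_ge_increment:
  fixes G :: "(real ^ 'n) set \<Rightarrow> real"
  assumes K: "K \<in> convex_bodies" and L: "L \<in> convex_bodies"
    and superadd: "\<And>A B. A \<in> convex_bodies \<Longrightarrow> B \<in> convex_bodies \<Longrightarrow> G (A + B) \<ge> G A + G B"
    and homog: "\<And>A t. A \<in> convex_bodies \<Longrightarrow> t > 0 \<Longrightarrow> G ((*\<^sub>R) t ` A) = t * G A"
    and deriv: "((\<lambda>t. G (K + (*\<^sub>R) t ` L)) has_real_derivative D) (at_right 0)"
  shows "D \<ge> G (K + L) - G K"
proof -
  have K0: "K + (*\<^sub>R) 0 ` L = K"
    using L by (intro plus_scaleR_zero) (auto simp: convex_bodies_def)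
  have "((\<lambda>t. (G (K + (*\<^sub>R) t ` L) - G K) / t) \<longlongrightarrow> D) (at_right 0)"
    using deriv unfolding has_field_derivative_iff by (simp only: K0 diff_zero)
  moreover have "\<forall>\<^sub>F t in at_right 0. (G (K + (*\<^sub>R) t ` L) - G K) / t \<ge> G (K + L) - G K"
    using eventually_at_right_real[OF zero_less_one]
  proof eventually_elim
    case (elim s)
    then have s: "0 < s" "s < 1" by auto
    have KL: "K + L \<in> convex_bodies"
      using K L by (rule convex_bodies_plus)
    have "G (K + (*\<^sub>R) s ` L) = G ((*\<^sub>R) (1 - s) ` K + (*\<^sub>R) s ` (K + L))"
      using K s plus_scaleR_eq_segment[of K s L] by (simp add: convex_bodies_def)
    also have "\<dots> \<ge> (1 - s) * G K + s * G (K + L)"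
      using superadd[of "(*\<^sub>R) (1 - s) ` K" "(*\<^sub>R) s ` (K + L)"] K KL s
      by (simp add: homog convex_bodies_scaleR)
    finally have "s * (G (K + L) - G K) \<le> G (K + (*\<^sub>R) s ` L) - G K"
      by (simp add: algebra_simps)
    with s show ?case
      by (simp add: pos_le_divide_eq mult.commute)
  qed
  ultimately show ?thesis
    by (intro tendsto_lowerbound) auto
qed

theorem theorem3p6:
  fixes \<mu> :: "(real ^ 'n) set \<Rightarrow> (real ^ 'n) measure"
    and F :: "(real ^ 'n) set \<Rightarrow> real"
    and \<alpha> :: real
  assumes "\<alpha> \<noteq> 0" and "\<alpha> \<noteq> 1"
    and "homogeneous_parametrization (\<alpha> - 1) \<mu>"
    and F_def: "\<And>K. K \<in> convex_bodies \<Longrightarrow>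
      F K = 1 / \<bar>\<alpha>\<bar> * (\<integral>\<nu>. support_function K \<nu> \<partial>\<mu> K)"
    and F_pos: "\<And>K. K \<in> convex_bodies \<Longrightarrow> F K > 0"
    and BM: "\<And>K L. K \<in> convex_bodies \<Longrightarrow> L \<in> convex_bodies \<Longrightarrow>
      F (K + L) powr (1 / \<alpha>) \<ge> F K powr (1 / \<alpha>) + F L powr (1 / \<alpha>)"
    and variation: "\<And>K L. K \<in> convex_bodies \<Longrightarrow> L \<in> convex_bodies \<Longrightarrow>
      ((\<lambda>t. F (K + (*\<^sub>R) t ` L)) has_real_derivative
        \<alpha> / \<bar>\<alpha>\<bar> * (\<integral>\<nu>. support_function L \<nu> \<partial>\<mu> K)) (at_right 0)"
  shows "(\<forall>K\<in>convex_bodies. \<forall>L\<in>convex_bodies. \<forall>M. is_mu_sum \<mu> K L M \<longrightarrow>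
            F M powr (1 - 1 / \<alpha>) \<ge> F K powr (1 - 1 / \<alpha>) + F L powr (1 - 1 / \<alpha>)) \<and>
         ((\<forall>K\<in>convex_bodies. \<forall>L\<in>convex_bodies.
              F (K + L) powr (1 / \<alpha>) = F K powr (1 / \<alpha>) + F L powr (1 / \<alpha>)
                \<longrightarrow> homothetic K L) \<longrightarrow>
          (\<forall>K\<in>convex_bodies. \<forall>L\<in>convex_bodies. \<forall>M. is_mu_sum \<mu> K L M \<longrightarrow>
              F M powr (1 - 1 / \<alpha>) = F K powr (1 - 1 / \<alpha>) + F L powr (1 - 1 / \<alpha>)
                \<longrightarrow> homothetic K L))"
proof -
  have param: "parametrization \<mu>"
    and \<mu>_scale: "\<And>K t. K \<in> convex_bodies \<Longrightarrow> t > 0 \<Longrightarrow>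
      \<mu> ((*\<^sub>R) t ` K) = scale_measure (ennreal (t powr (\<alpha> - 1))) (\<mu> K)"
    using assms(3) by (auto simp: homogeneous_parametrization_def)
  have sets_\<mu>: "sets (\<mu> K) = sets (restrict_space borel (sphere 0 1))" if "K \<in> convex_bodies" for K
    using param that by (auto simp: parametrization_def sphere_measures_def)

  define G where "G K = F K powr (1 / \<alpha>)" for K
  define W where "W K M = 1 / \<bar>\<alpha>\<bar> * (\<integral>\<nu>. support_function M \<nu> \<partial>\<mu> K)" for K M
  have G_pos: "G K > 0" if "K \<in> convex_bodies" for K
    using F_pos[OF that] by (simp add: G_def)

  have F_homog: "F ((*\<^sub>R) t ` K) = t powr \<alpha> * F K" if K: "K \<in> convex_bodies" and t: "t > 0" for K t
  proof -
    have "compact K" "K \<noteq> {}" using K by (auto simp: convex_bodies_def)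
    with K t have "F ((*\<^sub>R) t ` K) = (t powr (\<alpha> - 1) * t) * F K"
      by (simp add: F_def convex_bodies_scaleR \<mu>_scale support_function_scaleR
          integral_scale_measure)
    also have "t powr (\<alpha> - 1) * t = t powr \<alpha>"
      using t by (simp add: powr_diff)
    finally show ?thesis .
  qed
  have G_homog: "G ((*\<^sub>R) t ` K) = t * G K" if "K \<in> convex_bodies" "t > 0" for K t
    using that assms(1) F_pos[OF that(1)]
    by (simp add: G_def F_homog powr_mult powr_powr)
  have G_superadd: "G (K + L) \<ge> G K + G L" if "K \<in> convex_bodies" "L \<in> convex_bodies" for K L
    using BM[OF that] by (simp add: G_def)

  have W_ge: "W K M \<ge> F K powr (1 - 1 / \<alpha>) * (G (K + M) - G K)"
    if K: "K \<in> convex_bodies" and M: "M \<in> convex_bodies" for K M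
  proof -
    let ?V = "\<alpha> / \<bar>\<alpha>\<bar> * (\<integral>\<nu>. support_function M \<nu> \<partial>\<mu> K)"
    have K0: "K + (*\<^sub>R) 0 ` M = K"
      using M by (intro plus_scaleR_zero) (auto simp: convex_bodies_def)
    have "((\<lambda>x. x powr (1 / \<alpha>)) has_real_derivative 1 / \<alpha> * F K powr (1 / \<alpha> - 1))
        (at (F (K + (*\<^sub>R) 0 ` M)))"
      using has_real_derivative_powr[OF F_pos[OF K]] unfolding K0 .
    then have "((\<lambda>t. G (K + (*\<^sub>R) t ` M)) has_real_derivative
        1 / \<alpha> * F K powr (1 / \<alpha> - 1) * ?V) (at_right 0)"
      unfolding G_def by (rule DERIV_chain2[OF _ variation[OF K M]])
    \<comment> \<open>The exponent \<open>1 / \<alpha>\<close> contributes the same sign as \<open>\<alpha> / \<bar>\<alpha>\<bar>\<close>, so the slope is a positive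
      multiple of \<open>W K M\<close> even when \<open>\<alpha> < 0\<close>.\<close>
    moreover have "1 / \<alpha> * F K powr (1 / \<alpha> - 1) * ?V = F K powr (1 / \<alpha> - 1) * W K M"
      using assms(1) by (simp add: W_def)
    ultimately have "F K powr (1 / \<alpha> - 1) * W K M \<ge> G (K + M) - G K"
      using first_variation_ge_increment[OF K M G_superadd G_homog] by simp
    then have "F K powr (1 - 1 / \<alpha>) * (G (K + M) - G K)
        \<le> F K powr (1 - 1 / \<alpha>) * (F K powr (1 / \<alpha> - 1) * W K M)"
      by (intro mult_left_mono) auto
    also have "\<dots> = W K M"
      using F_pos[OF K] by (simp flip: powr_add mult.assoc)
    finally show ?thesis .
  qed

  have F_mu_sum: "F M = W K M + W L M"
    if K: "K \<in> convex_bodies" and L: "L \<in> convex_bodies" and "is_mu_sum \<mu> K L M" for K L M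
  proof -
    from that have M: "M \<in> convex_bodies" and \<mu>M: "\<mu> M = add_measure (\<mu> K) (\<mu> L)"
      by (auto simp: is_mu_sum_def)
    \<comment> \<open>A non-integrable function has integral \<open>0\<close>, so positivity of \<open>F M\<close> already provides
      integrability.\<close>
    have "integrable (\<mu> M) (support_function M)"
      using F_pos[OF M] F_def[OF M] not_integrable_integral_eq by force
    then show ?thesis
      using integral_add_measure[of "\<mu> K" "\<mu> L" "support_function M"] F_def[OF M] sets_\<mu> K L
      by (simp add: \<mu>M W_def algebra_simps add_divide_distrib)
  qed

  have F_split: "F M = F M powr (1 - 1 / \<alpha>) * G M" if "M \<in> convex_bodies" for M
    using F_pos[OF that] by (simp add: G_def flip: powr_add)

  show ?thesis
  proof (intro conjI impI ballI allI)
    fix K L M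
    assume K: "K \<in> convex_bodies" and L: "L \<in> convex_bodies" and sum: "is_mu_sum \<mu> K L M"
    then have M: "M \<in> convex_bodies" by (simp add: is_mu_sum_def)
    let ?k = "F K powr (1 - 1 / \<alpha>)" and ?l = "F L powr (1 - 1 / \<alpha>)"
    let ?m = "F M powr (1 - 1 / \<alpha>)"
    have kl: "?k > 0" "?l > 0" using F_pos[OF K] F_pos[OF L] by auto
    have incr: "G (K + M) - G K \<ge> G M" "G (L + M) - G L \<ge> G M"
      using G_superadd[OF K M] G_superadd[OF L M] by auto
    have le: "?k * (G (K + M) - G K) + ?l * (G (L + M) - G L) \<le> ?m * G M"
      using W_ge[OF K M] W_ge[OF L M] F_mu_sum[OF K L sum] F_split[OF M] by linarith
    have minkowski: "?k * G M \<le> ?k * (G (K + M) - G K)" "?l * G M \<le> ?l * (G (L + M) - G L)"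
      using incr kl by (auto intro!: mult_left_mono)
    have "(?k + ?l) * G M \<le> ?m * G M"
      using le minkowski unfolding distrib_right by linarith
    then show "?m \<ge> ?k + ?l"
      using G_pos[OF M] by simp
    assume eq_BM: "\<forall>K\<in>convex_bodies. \<forall>L\<in>convex_bodies.
        F (K + L) powr (1 / \<alpha>) = F K powr (1 / \<alpha>) + F L powr (1 / \<alpha>) \<longrightarrow> homothetic K L"
      and eq_KS: "?m = ?k + ?l"
    have "?m * G M = ?k * G M + ?l * G M"
      by (simp add: eq_KS distrib_right)
    with le minkowski have "?k * (G (K + M) - G K) = ?k * G M"
      "?l * (G (L + M) - G L) = ?l * G M"
      by linarith+
    with kl have "G (K + M) = G K + G M" "G (L + M) = G L + G M"
      by auto
    then have "homothetic K M" "homothetic L M"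
      using eq_BM K L M by (auto simp: G_def)
    then show "homothetic K L"
      by (blast intro: homothetic_sym homothetic_trans)
  qed
qed

end
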